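(* Let $b_1,b_2:[0,\infty)\to\mathbb R$ be càdlàg functions with $b_1(t)\le b_2(t)$ for all $t\ge0$. For $x\ge b_2(0)$ and $i=1,2$, define $$Y_i(t):=\sup_{0\le s\le t}\left(b_i(s)-x-\theta s-\sigma B(s)\right)^+,\qquad Z_i(t):=x+\theta t+\sigma B(t)+Y_i(t).$$ Then for all $t\ge0$, $$Y_1(t)\le Y_2(t),\qquad Z_1(t)\le Z_2(t)\qquad\text{a.s.}$$
   Context: $B$ is a standard Brownian motion, $\theta<0$, $\sigma>0$; $a^+:=\max\{a,0\}$; càdlàg means right-continuous with left limits. *)

theory Defs
  imports "HOL-Probability.Probability"
begin

(* B t is only constrained for t >= 0. *)
locale standard_brownian_motion = prob_space M
  for M :: "'a measure" and B :: "real \<Rightarrow> 'a \<Rightarrow> real" +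
  assumes rv: "0 \<le> t \<Longrightarrow> random_variable borel (B t)"
    and start: "AE \<omega> in M. B 0 \<omega> = 0"
    and indep_increments:
      "\<And>(n::nat) (u :: nat \<Rightarrow> real). 0 \<le> u 0 \<Longrightarrow> (\<And>i. i < n \<Longrightarrow> u i \<le> u (Suc i)) \<Longrightarrow>
         indep_vars (\<lambda>_. borel) (\<lambda>i \<omega>. B (u (Suc i)) \<omega> - B (u i) \<omega>) {..<n}"
    and normal_increments:
      "0 \<le> s \<Longrightarrow> s < t \<Longrightarrow>
         distributed M lborel (\<lambda>\<omega>. B t \<omega> - B s \<omega>) (normal_density 0 (sqrt (t - s)))"
    and continuous_paths: "AE \<omega> in M. continuous_on {0..} (\<lambda>t. B t \<omega>)"

(* Functions on [0,\<infinity>) are represented by functions on the reals whose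
   values at negative arguments are irrelevant; in particular no left limit is required at 0. *)
definition cadlag :: "(real \<Rightarrow> real) \<Rightarrow> bool" where
  "cadlag b \<longleftrightarrow>
     (\<forall>t\<ge>0. (b \<longlongrightarrow> b t) (at_right t)) \<and>
     (\<forall>t>0. \<exists>l. (b \<longlongrightarrow> l) (at_left t))"

(* The real-valued supremum is a genuine one whenever b is cadlag and the path of B at \<omega>
   is continuous: the family is then bounded on the compact interval {0..t}. *)
definition Y ::
  "(real \<Rightarrow> 'a \<Rightarrow> real) \<Rightarrow> real \<Rightarrow> real \<Rightarrow> real \<Rightarrow> (real \<Rightarrow> real) \<Rightarrow> real \<Rightarrow> 'a \<Rightarrow> real" where
  "Y B \<theta> \<sigma> x b t \<omega> = (SUP s\<in>{0..t}. max (b s - x - \<theta> * s - \<sigma> * B s \<omega>) 0)"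

definition Z ::
  "(real \<Rightarrow> 'a \<Rightarrow> real) \<Rightarrow> real \<Rightarrow> real \<Rightarrow> real \<Rightarrow> (real \<Rightarrow> real) \<Rightarrow> real \<Rightarrow> 'a \<Rightarrow> real" where
  "Z B \<theta> \<sigma> x b t \<omega> = x + \<theta> * t + \<sigma> * B t \<omega> + Y B \<theta> \<sigma> x b t \<omega>"

end

theory Submission
  imports Defs
begin

text \<open>
  For a fixed path, \<open>Y\<close> is a running supremum of functions that are pointwise monotone in the barrier
  \<open>b\<close>, and \<open>Z\<close> differs from \<open>Y\<close> by a term that does not involve \<open>b\<close>; so both inequalities follow
  from monotonicity of the supremum. In the reals this monotonicity requires the larger family to be
  bounded above, since the supremum of an unbounded set carries no order information. Hence the
  actual content is boundedness on compact time intervals: a cadlag function is bounded on \<open>{0..t}\<close>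
  (\<open>cadlag_imp_bounded\<close>), and almost every path of Brownian motion is continuous, therefore bounded
  there too. The exceptional null set is that of the discontinuous paths; it does not depend
  on \<open>t\<close>, so the inequalities hold almost surely for all times simultaneously.
\<close>

text \<open>
  The one-sided limits bound the function on each side of a point, hence on the nonnegative
  part of every short interval around that point; bisection passes from local to global boundedness.
\<close>
lemma cadlag_imp_bounded:
  assumes "cadlag b"
  shows "bounded (b ` {0..t})"
proof (cases "0 \<le> t")
  case True
  \<comment> \<open>Short intervals around 0 reach into the negative half-line, where \<open>b\<close> is unconstrained.\<close>
  from True have "bounded (b ` ({0..t} \<inter> {0..}))"
  proof (induction rule: Bolzano[where P = "\<lambda>p q. bounded (b ` ({p..q} \<inter> {0..}))"])
    case (trans p q r)
    have "{p..r} = {p..q} \<union> {q..r}"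
      using trans by auto
    with trans show ?case
      by (simp add: Int_Un_distrib2 image_Un)
  next
    case (local x)
    have "(b \<longlongrightarrow> b x) (at_right x)"
      using assms local by (simp add: cadlag_def)
    then have "\<forall>\<^sub>F y in at_right x. dist (b y) (b x) < 1"
      by (rule tendstoD) simp
    then obtain u where u: "x < u" "\<And>y. x < y \<Longrightarrow> y < u \<Longrightarrow> dist (b y) (b x) < 1"
      by (auto simp: eventually_at_right_field)
    have "\<exists>l w. w < x \<and> (\<forall>y. 0 \<le> y \<longrightarrow> w < y \<longrightarrow> y < x \<longrightarrow> dist (b y) l < 1)"
    proof (cases "x = 0")
      case True
      then show ?thesis
        by (intro exI[of _ 0] exI[of _ "-1"]) auto
    next
      case False
      with local have "0 < x"
        by simp
      moreover have "\<forall>t>0. \<exists>l. (b \<longlongrightarrow> l) (at_left t)"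
        using assms by (simp add: cadlag_def)
      ultimately obtain l where "(b \<longlongrightarrow> l) (at_left x)"
        by metis
      then have "\<forall>\<^sub>F y in at_left x. dist (b y) l < 1"
        by (rule tendstoD) simp
      then show ?thesis
        by (auto simp: eventually_at_left_field)
    qed
    then obtain l w
      where w: "w < x" "\<And>y. 0 \<le> y \<Longrightarrow> w < y \<Longrightarrow> y < x \<Longrightarrow> dist (b y) l < 1"
      by blast
    show ?case
    proof (intro exI[of _ "min (u - x) (x - w)"] conjI allI impI)
      show "0 < min (u - x) (x - w)"
        using u w by simp
    next
      fix p q
      assume pq: "p \<le> x \<and> x \<le> q \<and> q - p < min (u - x) (x - w)"
      have "b ` ({p..q} \<inter> {0..}) \<subseteq> ball (b x) 1 \<union> ball l 1"
      proof safe
        fix y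
        assume y: "y \<in> {p..q}" "0 \<le> y" "b y \<notin> ball l 1"
        consider "y < x" | "y = x" | "x < y" by linarith
        then show "b y \<in> ball (b x) 1"
        proof cases
          case 1
          then show ?thesis using w(2)[of y] y pq by (auto simp: dist_commute)
        next
          case 3
          then show ?thesis using u(2)[of y] y pq by (auto simp: dist_commute)
        qed simp
      qed
      then show "bounded (b ` ({p..q} \<inter> {0..}))"
        by (rule bounded_subset[rotated]) simp
    qed
  qed
  moreover have "{0..t} \<inter> {0..} = {0..t}"
    by auto
  ultimately show ?thesis
    by simp
qed simp

lemma bdd_above_Y_family:
  assumes "cadlag b" and "continuous_on {0..} (\<lambda>t. B t \<omega>)"
  shows "bdd_above ((\<lambda>s. max (b s - x - \<theta> * s - \<sigma> * B s \<omega>) 0) ` {0..t})"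
proof -
  have "continuous_on {0..t} (\<lambda>s. x + \<theta> * s + \<sigma> * B s \<omega>)"
    by (intro continuous_intros continuous_on_subset[OF assms(2)]) auto
  then have "bounded ((\<lambda>s. x + \<theta> * s + \<sigma> * B s \<omega>) ` {0..t})"
    by (intro compact_imp_bounded compact_continuous_image) auto
  then have "bounded ((\<lambda>s. b s - (x + \<theta> * s + \<sigma> * B s \<omega>)) ` {0..t})"
    by (intro bounded_minus_comp cadlag_imp_bounded[OF assms(1)])
  then have "bdd_above ((\<lambda>s. b s - (x + \<theta> * s + \<sigma> * B s \<omega>)) ` {0..t})"
    by (rule bounded_imp_bdd_above)
  then obtain K where "\<forall>s\<in>{0..t}. b s - (x + \<theta> * s + \<sigma> * B s \<omega>) \<le> K"
    unfolding bdd_above_def by (auto simp only: ball_simps)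
  then show ?thesis
    by (intro bdd_aboveI2[where M = "max K 0"] max.mono) (auto simp: algebra_simps)
qed

lemma Y_mono:
  assumes "cadlag b\<^sub>2" and "continuous_on {0..} (\<lambda>t. B t \<omega>)"
    and "\<And>s. 0 \<le> s \<Longrightarrow> b\<^sub>1 s \<le> b\<^sub>2 s" and "0 \<le> t"
  shows "Y B \<theta> \<sigma> x b\<^sub>1 t \<omega> \<le> Y B \<theta> \<sigma> x b\<^sub>2 t \<omega>"
  unfolding Y_def
proof (rule cSUP_mono)
  show "bdd_above ((\<lambda>s. max (b\<^sub>2 s - x - \<theta> * s - \<sigma> * B s \<omega>) 0) ` {0..t})"
    by (rule bdd_above_Y_family[where B = B and \<omega> = \<omega>, OF assms(1,2)])
  fix s assume "s \<in> {0..t}"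
  then show "\<exists>s'\<in>{0..t}. max (b\<^sub>1 s - x - \<theta> * s - \<sigma> * B s \<omega>) 0
                       \<le> max (b\<^sub>2 s' - x - \<theta> * s' - \<sigma> * B s' \<omega>) 0"
    using assms(3)[of s] by (intro bexI[of _ s] max.mono) auto
qed (use assms(4) in simp)

theorem lemma5:
  fixes M :: "'a measure" and B :: "real \<Rightarrow> 'a \<Rightarrow> real"
    and \<theta> \<sigma> x :: real and b\<^sub>1 b\<^sub>2 :: "real \<Rightarrow> real"
  assumes "standard_brownian_motion M B"
    and "\<theta> < 0" and "\<sigma> > 0"
    and "cadlag b\<^sub>1" and "cadlag b\<^sub>2"
    and "\<And>t. 0 \<le> t \<Longrightarrow> b\<^sub>1 t \<le> b\<^sub>2 t"
    and "b\<^sub>2 0 \<le> x"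
  shows "AE \<omega> in M. \<forall>t\<ge>0.
           Y B \<theta> \<sigma> x b\<^sub>1 t \<omega> \<le> Y B \<theta> \<sigma> x b\<^sub>2 t \<omega> \<and>
           Z B \<theta> \<sigma> x b\<^sub>1 t \<omega> \<le> Z B \<theta> \<sigma> x b\<^sub>2 t \<omega>"
  using standard_brownian_motion.continuous_paths[OF assms(1)]
proof eventually_elim
  case (elim \<omega>)
  have "Y B \<theta> \<sigma> x b\<^sub>1 t \<omega> \<le> Y B \<theta> \<sigma> x b\<^sub>2 t \<omega>" if "0 \<le> t" for t
    by (rule Y_mono) (use assms(5,6) elim that in auto)
  then show ?case
    by (simp add: Z_def)
qed

end
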